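(* Let $n$ be a positive integer and let $\mathcal{B}=\{v_1,\dots,v_n,v_{n+1}\}\subset\mathbb{R}^n$ be a frame with $\|v_j\|=1$ for every $j$, which does not contain an orthonormal basis of $\mathbb{R}^n$. For $i\ne j$ let $\theta_{i,j}\in[0,\pi)$ be the angle between $v_i$ and $v_j$. If $\mathcal{B}$ is scalable, then for every $1\le i\le n+1$, all indices $j,k$ such that $i,j,k$ are pairwise distinct, and all indices $j',k'$ such that $i,j',k'$ are pairwise distinct, $$\frac{|\cos\theta_{k,j}|}{|\cos\theta_{k,j}|+|\cos\theta_{k,i}\cos\theta_{j,i}|}=\frac{|\cos\theta_{k',j'}|}{|\cos\theta_{k',j'}|+|\cos\theta_{k',i}\cos\theta_{j',i}|}.$$
   Context: $\langle\cdot,\cdot\rangle$ and $\|\cdot\|$ are the usual scalar product and norm on $\mathbb{R}^n$. A (finite, indexed) family $\{u_1,\dots,u_N\}$ of vectors in $\mathbb{R}^n$ is a frame if it contains a basis of $\mathbb{R}^n$; it is a Parseval frame if $\sum_{j=1}^N\langle v,u_j\rangle^2=\|v\|^2$ for every $v\in\mathbb{R}^n$. A frame $\{v_1,\dots,v_N\}$ is scalable if there exist positive constants $\ell_1,\dots,\ell_N$ such that $\{\ell_1v_1,\dots,\ell_Nv_N\}$ is a Parseval frame.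
   Formalization: The equality is asserted only when both denominators are nonzero; otherwise a fraction can be 0/0, e.g. in R^3 for three Mercedes-Benz vectors of a plane together with its unit normal. *)

theory Defs
  imports "HOL-Analysis.Analysis"
begin

text \<open>
  A finite indexed family is a pair of a finite index set \<open>I\<close> and a function \<open>u\<close>; only the values
  of \<open>u\<close> on \<open>I\<close> matter. Repeated vectors are allowed.
\<close>

definition is_frame :: "'i set \<Rightarrow> ('i \<Rightarrow> 'a::euclidean_space) \<Rightarrow> bool" where
  "is_frame I u \<longleftrightarrow> finite I \<and> (\<exists>B \<subseteq> u ` I. independent B \<and> span B = UNIV)"

definition is_parseval_frame :: "'i set \<Rightarrow> ('i \<Rightarrow> 'a::euclidean_space) \<Rightarrow> bool" where
  "is_parseval_frame I u \<longleftrightarrow>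
     is_frame I u \<and> (\<forall>v. (\<Sum>j\<in>I. (v \<bullet> u j)\<^sup>2) = (norm v)\<^sup>2)"

definition is_scalable :: "'i set \<Rightarrow> ('i \<Rightarrow> 'a::euclidean_space) \<Rightarrow> bool" where
  "is_scalable I v \<longleftrightarrow>
     is_frame I v \<and>
     (\<exists>l :: 'i \<Rightarrow> real. (\<forall>j\<in>I. l j > 0) \<and> is_parseval_frame I (\<lambda>j. l j *\<^sub>R v j))"

definition is_orthonormal_basis :: "'a::euclidean_space set \<Rightarrow> bool" where
  "is_orthonormal_basis B \<longleftrightarrow>
     pairwise orthogonal B \<and> (\<forall>x\<in>B. norm x = 1) \<and> independent B \<and> span B = UNIV"

text \<open>
  The values lie in \<open>{0..pi}\<close>; the value \<open>pi\<close> occurs exactly for vectors in opposite directions.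
  Only used for nonzero vectors.
\<close>

definition angle_between :: "'a::euclidean_space \<Rightarrow> 'a \<Rightarrow> real" where
  "angle_between x y = arccos ((x \<bullet> y) / (norm x * norm y))"

end

theory Submission
  imports Defs
begin

text \<open>
  Write \<open>w\<^sub>j = \<ell>\<^sub>j v\<^sub>j\<close> for the Parseval frame obtained by scaling, and \<open>G = (\<langle>w\<^sub>j, w\<^sub>k\<rangle>)\<close> for its
  Gram matrix. The Parseval identity makes \<open>G\<close> an orthogonal projection of trace \<open>n\<close> on
  \<open>\<real>\<^bsup>n+1\<^esup>\<close>, so that \<open>P = 1 - G\<close> is an orthogonal projection of trace \<open>1\<close>, hence of rank one,
  and its \<open>2 \<times> 2\<close> minors vanish (\<open>trace_one_projection_minor\<close>). The minor
  \<open>P\<^sub>i\<^sub>i P\<^sub>k\<^sub>j = P\<^sub>k\<^sub>i P\<^sub>j\<^sub>i\<close>, for distinct \<open>i, j, k\<close>, reads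
  \<open>(1 - \<ell>\<^sub>i\<^sup>2) cos \<theta>\<^sub>k\<^sub>j = - \<ell>\<^sub>i\<^sup>2 cos \<theta>\<^sub>k\<^sub>i cos \<theta>\<^sub>j\<^sub>i\<close> after the factors \<open>\<ell>\<^sub>k \<ell>\<^sub>j\<close> are cancelled.
  Since \<open>\<ell>\<^sub>i \<le> 1\<close>, taking absolute values shows that \<open>\<bar>cos \<theta>\<^sub>k\<^sub>j\<bar>\<close> is \<open>\<ell>\<^sub>i\<^sup>2\<close> times the denominator
  (\<open>scaled_coherence\<close>), so that the quotient, where defined, is \<open>\<ell>\<^sub>i\<^sup>2\<close> whatever \<open>j\<close> and \<open>k\<close> are.
\<close>

text \<open>Polarization of the Parseval identity.\<close>

lemma parseval_inner:
  fixes w :: "'i \<Rightarrow> 'a::euclidean_space"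
  assumes "is_parseval_frame I w"
  shows "(\<Sum>j\<in>I. (x \<bullet> w j) * (w j \<bullet> y)) = x \<bullet> y"
proof -
  have par: "(\<Sum>j\<in>I. (z \<bullet> w j)\<^sup>2) = z \<bullet> z" for z
    using assms by (simp add: is_parseval_frame_def power2_norm_eq_inner)
  have "(\<Sum>j\<in>I. ((x + y) \<bullet> w j)\<^sup>2) =
        (\<Sum>j\<in>I. (x \<bullet> w j)\<^sup>2) + 2 * (\<Sum>j\<in>I. (x \<bullet> w j) * (w j \<bullet> y)) + (\<Sum>j\<in>I. (y \<bullet> w j)\<^sup>2)"
    unfolding sum_distrib_left sum.distrib[symmetric]
    by (intro sum.cong refl) (simp add: inner_add_left power2_sum inner_commute[of _ y])
  then show ?thesis
    unfolding par by (simp add: inner_add_left inner_add_right inner_commute)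
qed

text \<open>
  The trace of the Gram matrix \<open>W\<^sup>T W\<close> equals that of the frame operator \<open>W W\<^sup>T\<close>, which is the
  identity: expand each \<open>w\<^sub>j\<close> in an orthonormal basis and sum over \<open>j\<close> first.
\<close>

lemma parseval_sum_norm:
  fixes w :: "'i \<Rightarrow> 'a::euclidean_space"
  assumes "is_parseval_frame I w"
  shows "(\<Sum>j\<in>I. w j \<bullet> w j) = DIM('a)"
proof -
  have "(\<Sum>j\<in>I. w j \<bullet> w j) = (\<Sum>j\<in>I. \<Sum>b\<in>Basis. (b \<bullet> w j) * (w j \<bullet> b))"
    by (intro sum.cong refl, subst euclidean_inner) (simp add: inner_commute)
  also have "\<dots> = (\<Sum>b\<in>Basis. \<Sum>j\<in>I. (b \<bullet> w j) * (w j \<bullet> b))"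
    by (rule sum.swap)
  also have "\<dots> = DIM('a)"
    by (simp add: parseval_inner[OF assms])
  finally show ?thesis .
qed

text \<open>
  A symmetric idempotent matrix of trace one has rank one. In elementary terms: the squared
  Frobenius norm of \<open>P\<^sub>i\<^sub>i P - p\<^sub>i p\<^sub>i\<^sup>T\<close>, where \<open>p\<^sub>i\<close> is the \<open>i\<close>-th column of \<open>P\<close>, expands to
  \<open>P\<^sub>i\<^sub>i\<^sup>2 \<parallel>P\<parallel>\<^sup>2 - 2 P\<^sub>i\<^sub>i \<langle>p\<^sub>i, P p\<^sub>i\<rangle> + \<parallel>p\<^sub>i\<parallel>\<^sup>4\<close>, and idempotence evaluates this to
  \<open>P\<^sub>i\<^sub>i\<^sup>2 (tr P - 1)\<close>.
\<close>

lemma trace_one_projection_minor: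
  fixes P :: "'i \<Rightarrow> 'i \<Rightarrow> real"
  assumes fin: "finite I"
    and sym: "\<And>j k. P j k = P k j"
    and idem: "\<And>j k. j \<in> I \<Longrightarrow> k \<in> I \<Longrightarrow> (\<Sum>m\<in>I. P j m * P m k) = P j k"
    and trace: "(\<Sum>j\<in>I. P j j) = 1"
    and i: "i \<in> I" and j: "j \<in> I" and k: "k \<in> I"
  shows "P i i * P j k = P i j * P i k"
proof -
  have row: "(\<Sum>k\<in>I. (P j k)\<^sup>2) = P j j" if "j \<in> I" for j
  proof -
    have "(\<Sum>k\<in>I. (P j k)\<^sup>2) = (\<Sum>k\<in>I. P j k * P k j)"
      by (intro sum.cong refl) (metis power2_eq_square sym)
    then show ?thesis
      using idem[OF that that] by simp
  qed
  have frob: "(\<Sum>j\<in>I. \<Sum>k\<in>I. (P j k)\<^sup>2) = 1"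
    using trace row by simp
  have quad: "(\<Sum>j\<in>I. \<Sum>k\<in>I. P j k * (P i j * P i k)) = P i i"
  proof -
    have "(\<Sum>k\<in>I. P j k * (P i j * P i k)) = (P i j)\<^sup>2" if "j \<in> I" for j
    proof -
      have "(\<Sum>k\<in>I. P j k * (P i j * P i k)) = P i j * (\<Sum>k\<in>I. P j k * P k i)"
        unfolding sum_distrib_left by (intro sum.cong refl) (metis mult.left_commute sym)
      also have "\<dots> = P i j * P i j"
        using idem[OF that i] sym[of j i] by simp
      finally show ?thesis
        by (simp add: power2_eq_square)
    qed
    then show ?thesis
      using row[OF i] by simp
  qed
  have prod: "(\<Sum>j\<in>I. \<Sum>k\<in>I. (P i j)\<^sup>2 * (P i k)\<^sup>2) = (P i i)\<^sup>2"
    by (simp add: sum_product[symmetric] row[OF i] power2_eq_square[of "P i i"])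
  have "(\<Sum>j\<in>I. \<Sum>k\<in>I. (P i i * P j k - P i j * P i k)\<^sup>2) =
        (\<Sum>j\<in>I. \<Sum>k\<in>I. (P i i)\<^sup>2 * (P j k)\<^sup>2 - 2 * P i i * (P j k * (P i j * P i k))
                       + (P i j)\<^sup>2 * (P i k)\<^sup>2)"
    by (intro sum.cong refl) (simp add: power2_diff power_mult_distrib mult_ac)
  also have "\<dots> = (P i i)\<^sup>2 * (\<Sum>j\<in>I. \<Sum>k\<in>I. (P j k)\<^sup>2)
      - 2 * P i i * (\<Sum>j\<in>I. \<Sum>k\<in>I. P j k * (P i j * P i k))
      + (\<Sum>j\<in>I. \<Sum>k\<in>I. (P i j)\<^sup>2 * (P i k)\<^sup>2)"
    by (simp only: sum.distrib sum_subtractf sum_distrib_left)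
  also have "\<dots> = 0"
    unfolding frob quad prod by (simp add: power2_eq_square)
  finally have "(\<Sum>j\<in>I. \<Sum>k\<in>I. (P i i * P j k - P i j * P i k)\<^sup>2) = 0" .
  then have "(\<Sum>k\<in>I. (P i i * P j k - P i j * P i k)\<^sup>2) = 0"
    using fin j by (subst (asm) sum_nonneg_eq_0_iff) (auto intro: sum_nonneg)
  then have "(P i i * P j k - P i j * P i k)\<^sup>2 = 0"
    using fin k by (subst (asm) sum_nonneg_eq_0_iff) auto
  then show ?thesis
    by simp
qed

text \<open>
  The complementary projection \<open>P = 1 - G\<close> of the Gram matrix has trace \<open>n + 1 - n = 1\<close>; its
  entries are \<open>1 - \<parallel>w\<^sub>i\<parallel>\<^sup>2\<close> on the diagonal and \<open>- \<langle>w\<^sub>j, w\<^sub>k\<rangle>\<close> off it.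
\<close>

lemma parseval_gram_minor:
  fixes w :: "'i \<Rightarrow> 'a::euclidean_space"
  assumes par: "is_parseval_frame I w" and card: "card I = DIM('a) + 1"
    and mem: "i \<in> I" "j \<in> I" "k \<in> I" and dist: "i \<noteq> j" "i \<noteq> k" "j \<noteq> k"
  shows "(1 - w i \<bullet> w i) * (w k \<bullet> w j) = - ((w k \<bullet> w i) * (w j \<bullet> w i))"
proof -
  define P where "P = (\<lambda>j k. (if j = k then 1 else 0) - w j \<bullet> w k)"
  have fin: "finite I"
    using par by (simp add: is_parseval_frame_def is_frame_def)
  have "(\<Sum>m\<in>I. P j m * P m k) = P j k" if "j \<in> I" "k \<in> I" for j k
  proof -
    \<comment> \<open>Summed over \<open>m\<close>, the three terms are the \<open>(j, k)\<close> entries of \<open>P\<close>, \<open>G\<close> and \<open>G\<^sup>2\<close>: \<open>P\<^sup>2 = P - G + G\<^sup>2\<close>.\<close>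
    have "(\<Sum>m\<in>I. P j m * P m k) =
          (\<Sum>m\<in>I. (if m = j then P j k else 0) - (if m = k then w j \<bullet> w k else 0)
                 + (w j \<bullet> w m) * (w m \<bullet> w k))"
      by (intro sum.cong refl) (auto simp: P_def algebra_simps)
    also have "\<dots> = P j k"
      using fin that by (simp add: sum.distrib sum_subtractf parseval_inner[OF par])
    finally show ?thesis .
  qed
  moreover have "(\<Sum>j\<in>I. P j j) = 1"
    by (simp add: P_def sum_subtractf parseval_sum_norm[OF par] card)
  moreover have "P j k = P k j" for j k
    by (simp add: P_def inner_commute)
  ultimately have "P i i * P k j = P i k * P i j"
    using fin mem by (intro trace_one_projection_minor[where I = I]) auto
  then show ?thesis
    using dist by (simp add: P_def inner_commute)
qed

text \<open>Testing the Parseval identity on \<open>w\<^sub>i\<close> itself, the \<open>i\<close>-th term gives \<open>\<parallel>w\<^sub>i\<parallel>\<^sup>4 \<le> \<parallel>w\<^sub>i\<parallel>\<^sup>2\<close>.\<close>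

lemma parseval_norm_le_one:
  fixes w :: "'i \<Rightarrow> 'a::euclidean_space"
  assumes "is_parseval_frame I w" and "i \<in> I"
  shows "norm (w i) \<le> 1"
proof -
  have "(w i \<bullet> w i)\<^sup>2 \<le> (\<Sum>j\<in>I. (w i \<bullet> w j)\<^sup>2)"
    using assms by (intro member_le_sum) (auto simp: is_parseval_frame_def is_frame_def)
  also have "\<dots> = (norm (w i))\<^sup>2"
    using assms by (simp add: is_parseval_frame_def)
  finally have "(norm (w i))\<^sup>2 * (norm (w i))\<^sup>2 \<le> (norm (w i))\<^sup>2 * 1"
    by (simp add: dot_square_norm power2_eq_square)
  then have "w i = 0 \<or> (norm (w i))\<^sup>2 \<le> 1"
    by (metis mult_le_cancel_left_pos zero_less_norm_iff zero_less_power)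
  then show ?thesis
    by (auto simp: abs_square_le_1)
qed

text \<open>
  The vanishing minor of the scaled vectors is homogeneous in \<open>\<ell>\<^sub>k\<close> and \<open>\<ell>\<^sub>j\<close>, so these cancel and
  only \<open>\<ell>\<^sub>i\<close> survives. Since \<open>v\<^sub>i\<close> has unit length, \<open>\<ell>\<^sub>i\<close> is the norm of a member of a Parseval
  frame, hence at most \<open>1\<close>; this fixes the sign of \<open>1 - \<ell>\<^sub>i\<^sup>2\<close> when absolute values are taken.
\<close>

lemma scaled_coherence:
  fixes v :: "'i \<Rightarrow> 'a::euclidean_space"
  assumes par: "is_parseval_frame I (\<lambda>j. l j *\<^sub>R v j)" and card: "card I = DIM('a) + 1"
    and pos: "\<forall>j\<in>I. l j > 0" and unit: "\<forall>j\<in>I. norm (v j) = 1"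
    and mem: "i \<in> I" "j \<in> I" "k \<in> I" and dist: "i \<noteq> j" "i \<noteq> k" "j \<noteq> k"
  shows "\<bar>v k \<bullet> v j\<bar> = (l i)\<^sup>2 * (\<bar>v k \<bullet> v j\<bar> + \<bar>(v k \<bullet> v i) * (v j \<bullet> v i)\<bar>)"
proof -
  have vi: "v i \<bullet> v i = 1"
    using unit mem by (simp add: norm_eq_1)
  have "l k * l j * ((1 - (l i)\<^sup>2) * (v k \<bullet> v j))
        = l k * l j * (- ((l i)\<^sup>2 * ((v k \<bullet> v i) * (v j \<bullet> v i))))"
    using parseval_gram_minor[OF par card mem dist] vi
    by (simp add: power2_eq_square mult_ac)
  moreover have "l k * l j \<noteq> 0"
    using pos mem by force
  ultimately have "(1 - (l i)\<^sup>2) * (v k \<bullet> v j) = - ((l i)\<^sup>2 * ((v k \<bullet> v i) * (v j \<bullet> v i)))"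
    by (metis mult_left_cancel)
  then have "\<bar>1 - (l i)\<^sup>2\<bar> * \<bar>v k \<bullet> v j\<bar> = (l i)\<^sup>2 * \<bar>(v k \<bullet> v i) * (v j \<bullet> v i)\<bar>"
    by (metis abs_minus_cancel abs_mult abs_power2)
  moreover have "(l i)\<^sup>2 \<le> 1"
    using parseval_norm_le_one[OF par mem(1)] unit mem pos
    by (simp add: abs_square_le_1)
  ultimately show ?thesis
    by (simp add: algebra_simps)
qed

lemma cos_angle_between_unit:
  assumes "norm x = 1" "norm y = 1"
  shows "cos (angle_between x y) = x \<bullet> y"
  using Cauchy_Schwarz_ineq2[of x y] assms
  by (simp add: angle_between_def cos_arccos_abs)

theorem corollary1p4:
  fixes v :: "nat \<Rightarrow> real ^ 'n"
    and \<theta> :: "nat \<Rightarrow> nat \<Rightarrow> real"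
  assumes frame: "is_frame {1..CARD('n) + 1} v"
    and unit: "\<forall>j\<in>{1..CARD('n) + 1}. norm (v j) = 1"
    and no_onb: "\<not> (\<exists>B \<subseteq> v ` {1..CARD('n) + 1}. is_orthonormal_basis B)"
    and angle: "\<forall>i\<in>{1..CARD('n) + 1}. \<forall>j\<in>{1..CARD('n) + 1}.
                  i \<noteq> j \<longrightarrow> \<theta> i j = angle_between (v i) (v j)"
    and scalable: "is_scalable {1..CARD('n) + 1} v"
  shows "\<forall>i\<in>{1..CARD('n) + 1}.
           \<forall>j\<in>{1..CARD('n) + 1}. \<forall>k\<in>{1..CARD('n) + 1}.
           \<forall>j'\<in>{1..CARD('n) + 1}. \<forall>k'\<in>{1..CARD('n) + 1}.
             i \<noteq> j \<and> i \<noteq> k \<and> j \<noteq> k \<and> i \<noteq> j' \<and> i \<noteq> k' \<and> j' \<noteq> k' \<longrightarrow>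
             \<bar>cos (\<theta> k j)\<bar> + \<bar>cos (\<theta> k i) * cos (\<theta> j i)\<bar> \<noteq> 0 \<longrightarrow>
             \<bar>cos (\<theta> k' j')\<bar> + \<bar>cos (\<theta> k' i) * cos (\<theta> j' i)\<bar> \<noteq> 0 \<longrightarrow>
             \<bar>cos (\<theta> k j)\<bar> / (\<bar>cos (\<theta> k j)\<bar> + \<bar>cos (\<theta> k i) * cos (\<theta> j i)\<bar>) =
             \<bar>cos (\<theta> k' j')\<bar> / (\<bar>cos (\<theta> k' j')\<bar> + \<bar>cos (\<theta> k' i) * cos (\<theta> j' i)\<bar>)"
proof (intro ballI impI)
  let ?I = "{1..CARD('n) + 1}"
  obtain l :: "nat \<Rightarrow> real" where pos: "\<forall>j\<in>?I. l j > 0"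
    and par: "is_parseval_frame ?I (\<lambda>j. l j *\<^sub>R v j)"
    using scalable by (auto simp: is_scalable_def)
  have cos_eq: "cos (\<theta> a b) = v a \<bullet> v b" if "a \<in> ?I" "b \<in> ?I" "a \<noteq> b" for a b
    using that angle unit by (simp add: cos_angle_between_unit)
  have card: "card ?I = DIM(real ^ 'n) + 1"
    by simp
  have quot: "\<bar>cos (\<theta> b a)\<bar> / (\<bar>cos (\<theta> b a)\<bar> + \<bar>cos (\<theta> b i) * cos (\<theta> a i)\<bar>) = (l i)\<^sup>2"
    if mem: "i \<in> ?I" "a \<in> ?I" "b \<in> ?I" and dist: "i \<noteq> a" "i \<noteq> b" "a \<noteq> b"
      and nz: "\<bar>cos (\<theta> b a)\<bar> + \<bar>cos (\<theta> b i) * cos (\<theta> a i)\<bar> \<noteq> 0" for i a b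
  proof -
    have "\<bar>cos (\<theta> b a)\<bar> = (l i)\<^sup>2 * (\<bar>cos (\<theta> b a)\<bar> + \<bar>cos (\<theta> b i) * cos (\<theta> a i)\<bar>)"
      using scaled_coherence[OF par card pos unit mem dist] mem dist
      by (simp only: cos_eq not_sym)
    with nz show ?thesis
      by (metis nonzero_divide_eq_eq)
  qed
  fix i j k j' k'
  assume mem: "i \<in> ?I" "j \<in> ?I" "k \<in> ?I" "j' \<in> ?I" "k' \<in> ?I"
    and dist: "i \<noteq> j \<and> i \<noteq> k \<and> j \<noteq> k \<and> i \<noteq> j' \<and> i \<noteq> k' \<and> j' \<noteq> k'"
    and nz: "\<bar>cos (\<theta> k j)\<bar> + \<bar>cos (\<theta> k i) * cos (\<theta> j i)\<bar> \<noteq> 0"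
    and nz': "\<bar>cos (\<theta> k' j')\<bar> + \<bar>cos (\<theta> k' i) * cos (\<theta> j' i)\<bar> \<noteq> 0"
  show "\<bar>cos (\<theta> k j)\<bar> / (\<bar>cos (\<theta> k j)\<bar> + \<bar>cos (\<theta> k i) * cos (\<theta> j i)\<bar>) =
        \<bar>cos (\<theta> k' j')\<bar> / (\<bar>cos (\<theta> k' j')\<bar> + \<bar>cos (\<theta> k' i) * cos (\<theta> j' i)\<bar>)"
    using mem dist quot[OF _ _ _ _ _ _ nz] quot[OF _ _ _ _ _ _ nz'] by simp
qed

end
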